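(* The maximal number of queens that can be placed on an $n\times n$ board in such a way that each of them attacks exactly one other queen equals $0,2,2,4,4$ for $n=1,2,3,4,5$, respectively, and equals $2\left\lfloor\frac{2n}{3}\right\rfloor$ for every $n\geqslant 6$.
   Context: The $n\times n$ board is the set of cells $(r,c)$ with $1\leqslant r,c\leqslant n$ (row $r$, column $c$). A placement of queens is a set of cells (possibly empty), the cells occupied by queens. Two distinct cells lie on a common line if they have the same row $r$, the same column $c$, the same difference $r-c$, or the same sum $r+c$. Two distinct queens attack each other if they lie on a common line and no other queen stands between them on that line. *)

theory Defs
  imports Complex_Main
begin

text \<open>Cells have integer coordinates (row, column), so that the difference \<open>r - c\<close> is a
  genuine one and not the truncated difference of natural numbers.\<close>

type_synonym cell = "int \<times> int"

definition board :: "nat \<Rightarrow> cell set" where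
  "board n = {1..int n} \<times> {1..int n}"

definition queen_lines :: "cell set set" where
  "queen_lines =
     range (\<lambda>k. {(r, c). r = k}) \<union>
     range (\<lambda>k. {(r, c). c = k}) \<union>
     range (\<lambda>k. {(r, c). r - c = k}) \<union>
     range (\<lambda>k. {(r, c). r + c = k})"

text \<open>Strictly between in the order of the cells along a line \<open>L\<close>: on every line of
  \<open>queen_lines\<close> each coordinate is either constant or strictly monotone, so for
  \<open>p\<close>, \<open>q\<close>, \<open>x\<close> on such a line this amounts to \<open>x\<close> lying in
  the bounding box of \<open>p\<close> and \<open>q\<close>.\<close>

definition between_on :: "cell set \<Rightarrow> cell \<Rightarrow> cell \<Rightarrow> cell \<Rightarrow> bool" where
  "between_on L p q x \<longleftrightarrow>
     x \<in> L \<and> x \<noteq> p \<and> x \<noteq> q \<and>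
     min (fst p) (fst q) \<le> fst x \<and> fst x \<le> max (fst p) (fst q) \<and>
     min (snd p) (snd q) \<le> snd x \<and> snd x \<le> max (snd p) (snd q)"

definition attacks :: "cell set \<Rightarrow> cell \<Rightarrow> cell \<Rightarrow> bool" where
  "attacks Q p q \<longleftrightarrow>
     p \<in> Q \<and> q \<in> Q \<and> p \<noteq> q \<and>
     (\<exists>L\<in>queen_lines. p \<in> L \<and> q \<in> L \<and> \<not> (\<exists>x\<in>Q. between_on L p q x))"

definition one_attack_placements :: "nat \<Rightarrow> cell set set" where
  "one_attack_placements n = {Q. Q \<subseteq> board n \<and> (\<forall>p\<in>Q. \<exists>!q. attacks Q p q)}"

definition max_queens :: "nat \<Rightarrow> nat" where
  "max_queens n = Max (card ` one_attack_placements n)"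

text \<open>The maximum is taken over a finite nonempty set, hence is attained.\<close>

lemma finite_one_attack_placements: "finite (one_attack_placements n)"
proof (rule finite_subset)
  show "one_attack_placements n \<subseteq> Pow (board n)"
    by (auto simp: one_attack_placements_def)
  show "finite (Pow (board n))"
    by (simp add: board_def)
qed

lemma empty_in_one_attack_placements: "{} \<in> one_attack_placements n"
  by (simp add: one_attack_placements_def)

end

theory Submission
  imports Defs
begin

text \<open>A queen placement in which every queen attacks exactly one other has at most two queens on
  each line, for the middle one of three queens would attack two. Hence attack and alignment
  coincide, and the queens fall into pairs of aligned queens with no alignment between different
  pairs (\<open>one_attack_iff_paired\<close>). A pair occupies at least three of the \<open>2 n\<close> rows and columns,
  which gives at most \<open>2 n div 3\<close> pairs (\<open>paired_card_le\<close>). This bound is attained except for \<open>n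
  = 3\<close> and \<open>n = 5\<close>, where an exhaustive search saves one pair (\<open>no_two_pairs_3\<close>,
  \<open>no_three_pairs_5\<close>).

  For the lower bound two constructions produce large placements from small ones. The product
  (\<open>optimal_in_band_product\<close>) replaces each queen by a toroidal solution of the \<open>q\<close> queens
  problem, with \<open>q\<close> coprime to \<open>6\<close>. The sum (\<open>optimal_in_band_sum\<close>) places two boards corner to
  corner along the main diagonal; then only the differences \<open>c - r\<close> can clash, and they do not
  if the first placement avoids a band around its main diagonal that contains all queens of the
  second. The product enlarges such a band together with the board. A placement of size 12 that
  avoids the differences \<open>-1, 0, 1\<close> grows into placements of size \<open>12 q\<close> that avoid a band wide
  enough for every corner board of size up to about \<open>3 q / 2\<close>, and the gaps between consecutive
  \<open>12 q\<close> are bounded. So all large sizes follow by induction (\<open>three_sizes_all\<close>), and the sizes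
  below 450 are combined in the same way from explicit placements (\<open>solved_below_450\<close>).\<close>

section \<open>Attack and alignment\<close>

text \<open>Alignment ignores blocking, so it is much easier to handle than attack; on the placements
  of interest both give the same relation.\<close>

definition aligned :: "cell \<Rightarrow> cell \<Rightarrow> bool" where
  "aligned p q \<longleftrightarrow> p \<noteq> q \<and>
     (fst p = fst q \<or> snd p = snd q \<or> fst p - snd p = fst q - snd q \<or> fst p + snd p = fst q + snd q)"

definition paired :: "cell set \<Rightarrow> bool" where
  "paired Q \<longleftrightarrow> (\<forall>p\<in>Q. \<exists>!q. q \<in> Q \<and> aligned p q)"

lemma aligned_sym: "aligned p q \<longleftrightarrow> aligned q p"
  unfolding aligned_def by auto

lemma aligned_iff_common_line:
  "aligned p q \<longleftrightarrow> p \<noteq> q \<and> (\<exists>L\<in>queen_lines. p \<in> L \<and> q \<in> L)"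
  by (simp add: aligned_def queen_lines_def bex_Un split_def) metis

lemma line_coordinate:
  assumes "L \<in> queen_lines"
  obtains f :: "cell \<Rightarrow> int" where "inj_on f L" "f = fst \<or> f = snd"
proof -
  have "inj_on fst L \<or> inj_on snd L"
    using assms unfolding queen_lines_def inj_on_def by auto
  then show ?thesis using that by blast
qed

text \<open>On a line a queen attacks its nearest neighbour on either side: a queen between the two
  would be nearer. The set \<open>B\<close> is one of the two sides, measured in a coordinate that is
  injective on the line.\<close>

lemma nearest_attacked:
  assumes "finite Q" and L: "L \<in> queen_lines" and f: "inj_on f L" "f = fst \<or> f = snd"
    and p: "p \<in> Q \<inter> L" and B: "B \<subseteq> Q \<inter> L" "B \<noteq> {}"
    and side: "B = {x \<in> Q \<inter> L. f x < f p} \<or> B = {x \<in> Q \<inter> L. f p < f x}"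
  shows "\<exists>b\<in>B. attacks Q p b"
proof -
  have fB: "finite B" using assms(1) B(1) by (meson finite_Int finite_subset)
  have "\<exists>b\<in>B. \<forall>x\<in>B. \<bar>f b - f p\<bar> \<le> \<bar>f x - f p\<bar>"
    using ex_is_arg_min_if_finite[OF fB B(2), of "\<lambda>x. \<bar>f x - f p\<bar>"]
    unfolding is_arg_min_linorder by blast
  then obtain b where b: "b \<in> B" "\<And>x. x \<in> B \<Longrightarrow> \<bar>f b - f p\<bar> \<le> \<bar>f x - f p\<bar>" by blast
  have bQ: "b \<in> Q" "b \<in> L" "f b \<noteq> f p" using b(1) B(1) side by auto
  have "\<not> between_on L p b x" if "x \<in> Q" for x
  proof
    assume bt: "between_on L p b x"
    then have x: "x \<in> L" "x \<noteq> p" "x \<noteq> b" "min (f p) (f b) \<le> f x" "f x \<le> max (f p) (f b)"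
      using f(2) unfolding between_on_def by auto
    have "f x \<noteq> f p" "f x \<noteq> f b"
      using x bQ p f(1) unfolding inj_on_def by auto
    then have "x \<in> B" "\<bar>f x - f p\<bar> < \<bar>f b - f p\<bar>"
      using x side b(1) that by auto
    then show False using b(2) by fastforce
  qed
  then have "attacks Q p b"
    using p bQ L unfolding attacks_def by (metis IntD1 IntD2)
  then show ?thesis using b(1) by blast
qed

lemma three_on_line_middle:
  assumes "inj_on (f :: cell \<Rightarrow> int) L" "x \<in> L" "y \<in> L" "z \<in> L" "x \<noteq> y" "y \<noteq> z" "x \<noteq> z"
  obtains m a b where "{m, a, b} = {x, y, z}" "f a < f m" "f m < f b"
proof -
  have "f x \<noteq> f y" "f y \<noteq> f z" "f x \<noteq> f z" using assms unfolding inj_on_def by auto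
  then consider "f x < f y \<and> f y < f z" | "f z < f y \<and> f y < f x" | "f y < f x \<and> f x < f z"
    | "f z < f x \<and> f x < f y" | "f x < f z \<and> f z < f y" | "f y < f z \<and> f z < f x" by linarith
  then show ?thesis
    by cases (use that[of y x z] that[of y z x] that[of x y z] that[of x z y] that[of z x y] that[of z y x]
        in \<open>simp_all add: insert_commute\<close>)
qed

text \<open>If three queens stood on one line, the middle one would attack its nearest neighbours on
  both sides. So when every queen attacks exactly one other, each line carries at most two
  queens, nothing is ever blocked, and aligned queens attack each other. Conversely, in a paired
  set a queen standing between two aligned queens would be a second queen aligned with the
  first.\<close>

lemma one_attack_iff_paired:
  assumes "finite Q"
  shows "(\<forall>p\<in>Q. \<exists>!q. attacks Q p q) \<longleftrightarrow> paired Q"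
proof
  assume H: "\<forall>p\<in>Q. \<exists>!q. attacks Q p q"
  have two: "x = y \<or> y = z \<or> x = z"
    if line: "L \<in> queen_lines" and Q: "x \<in> Q" "y \<in> Q" "z \<in> Q" and L: "x \<in> L" "y \<in> L" "z \<in> L"
    for L x y z
  proof (rule ccontr)
    assume ne: "\<not> (x = y \<or> y = z \<or> x = z)"
    obtain f where f: "inj_on f L" "f = fst \<or> f = snd" using line_coordinate line by blast
    obtain m a b where m: "{m, a, b} = {x, y, z}" "f a < f m" "f m < f b"
      using three_on_line_middle[OF f(1) L] ne by blast
    have "{m, a, b} \<subseteq> Q \<inter> L" unfolding m(1) using Q L by simp
    then have mem: "m \<in> Q \<inter> L" "a \<in> Q \<inter> L" "b \<in> Q \<inter> L" by auto
    have "\<exists>u\<in>{x \<in> Q \<inter> L. f x < f m}. attacks Q m u"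
      by (rule nearest_attacked[OF assms line f mem(1)]) (use mem m in blast)+
    moreover have "\<exists>u\<in>{x \<in> Q \<inter> L. f m < f x}. attacks Q m u"
      by (rule nearest_attacked[OF assms line f mem(1)]) (use mem m in blast)+
    ultimately obtain u v where "attacks Q m u" "attacks Q m v" "f u < f v" by fastforce
    then show False using H mem(1) by blast
  qed
  have "attacks Q p q \<longleftrightarrow> q \<in> Q \<and> aligned p q" if "p \<in> Q" for p q
  proof
    show "attacks Q p q \<Longrightarrow> q \<in> Q \<and> aligned p q"
      unfolding attacks_def aligned_iff_common_line by blast
    assume a: "q \<in> Q \<and> aligned p q"
    then obtain L where L: "L \<in> queen_lines" "p \<in> L" "q \<in> L" "p \<noteq> q"
      unfolding aligned_iff_common_line by blast
    have "\<not> between_on L p q x" if "x \<in> Q" for x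
      using two[OF L(1), of p q x] L a \<open>p \<in> Q\<close> that unfolding between_on_def by blast
    then show "attacks Q p q" unfolding attacks_def using L a that by blast
  qed
  with H show "paired Q" unfolding paired_def by simp
next
  assume P: "paired Q"
  have "attacks Q p q \<longleftrightarrow> q \<in> Q \<and> aligned p q" if "p \<in> Q" for p q
  proof
    show "attacks Q p q \<Longrightarrow> q \<in> Q \<and> aligned p q"
      unfolding attacks_def aligned_iff_common_line by blast
    assume a: "q \<in> Q \<and> aligned p q"
    then obtain L where L: "L \<in> queen_lines" "p \<in> L" "q \<in> L" "p \<noteq> q"
      unfolding aligned_iff_common_line by blast
    have "\<not> between_on L p q x" if x: "x \<in> Q" for x
    proof
      assume "between_on L p q x"
      then have "aligned p x" "x \<noteq> q"
        using L unfolding between_on_def aligned_iff_common_line by auto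
      then show False using P \<open>p \<in> Q\<close> a x unfolding paired_def by blast
    qed
    then show "attacks Q p q" unfolding attacks_def using L a that by blast
  qed
  with P show "\<forall>p\<in>Q. \<exists>!q. attacks Q p q" unfolding paired_def by simp
qed

lemma one_attack_placements_eq: "one_attack_placements n = {Q. Q \<subseteq> board n \<and> paired Q}"
proof -
  have "finite Q" if "Q \<subseteq> board n" for Q
    using that finite_subset[of Q "board n"] by (simp add: board_def)
  then have "Q \<subseteq> board n \<and> (\<forall>p\<in>Q. \<exists>!q. attacks Q p q) \<longleftrightarrow> Q \<subseteq> board n \<and> paired Q" for Q
    using one_attack_iff_paired by (cases "Q \<subseteq> board n") simp_all
  then show ?thesis unfolding one_attack_placements_def by simp
qed

section \<open>The upper bound\<close>

lemma paired_remove_pair: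
  assumes "paired Q" "p \<in> Q" "q \<in> Q" "aligned p q"
  shows "paired (Q - {p, q})" and "\<And>x. x \<in> Q - {p, q} \<Longrightarrow> \<not> aligned p x \<and> \<not> aligned q x"
proof -
  show far: "\<not> aligned p x \<and> \<not> aligned q x" if "x \<in> Q - {p, q}" for x
    using assms that aligned_sym unfolding paired_def by blast
  show "paired (Q - {p, q})"
    unfolding paired_def
  proof
    fix x assume x: "x \<in> Q - {p, q}"
    then have "y \<in> Q - {p, q} \<and> aligned x y \<longleftrightarrow> y \<in> Q \<and> aligned x y" for y
      using far aligned_sym by blast
    then show "\<exists>!y. y \<in> Q - {p, q} \<and> aligned x y" using assms(1) x unfolding paired_def by simp
  qed
qed

text \<open>Two aligned queens occupy at least three lines among the rows and columns: one row and two
  columns, two rows and one column, or two of each if they share a diagonal. No other queen uses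
  these lines, so the count follows by removing one pair at a time.\<close>

lemma paired_lines_count:
  assumes "finite Q" "paired Q"
  shows "even (card Q) \<and> 3 * card Q \<le> 2 * (card (fst ` Q) + card (snd ` Q))"
  using assms
proof (induction "card Q" arbitrary: Q rule: less_induct)
  case less
  show ?case
  proof (cases "Q = {}")
    case False
    then obtain p where p: "p \<in> Q" by blast
    then obtain q where q: "q \<in> Q" "aligned p q" using less.prems(2) unfolding paired_def by blast
    let ?R = "Q - {p, q}"
    have pq: "p \<noteq> q" using q(2) by (simp add: aligned_def)
    note rem = paired_remove_pair[OF less.prems(2) p q]
    have cQ: "card Q = card ?R + 2"
      using p q(1) pq less.prems(1) card_Diff_subset[of "{p, q}" Q] card_mono[of Q "{p, q}"] by auto
    have IH: "even (card ?R) \<and> 3 * card ?R \<le> 2 * (card (fst ` ?R) + card (snd ` ?R))"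
      using less.hyps[of ?R] less.prems(1) rem(1) cQ by simp
    have Q: "Q = ?R \<union> {p, q}" using p q(1) by blast
    have new: "card (f ` Q) = card (f ` ?R) + card {f p, f q}"
      if "\<And>x. x \<in> ?R \<Longrightarrow> f x \<noteq> f p \<and> f x \<noteq> f q" for f :: "cell \<Rightarrow> int"
    proof -
      have "f ` Q = f ` ?R \<union> {f p, f q}" using Q by blast
      moreover have "f ` ?R \<inter> {f p, f q} = {}" using that by blast
      ultimately show ?thesis using less.prems(1) by (simp add: card_Un_disjoint del: Un_insert_right)
    qed
    have "card (fst ` Q) = card (fst ` ?R) + card {fst p, fst q}"
      by (rule new) (metis rem(2) aligned_def DiffE insertCI)
    moreover have "card (snd ` Q) = card (snd ` ?R) + card {snd p, snd q}"
      by (rule new) (metis rem(2) aligned_def DiffE insertCI)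
    moreover have "card {fst p, fst q} + card {snd p, snd q} \<ge> 3"
      using pq by (cases "fst p = fst q"; cases "snd p = snd q") (auto simp: prod_eq_iff)
    ultimately have "card (fst ` Q) + card (snd ` Q) \<ge> card (fst ` ?R) + card (snd ` ?R) + 3" by linarith
    then show ?thesis using IH cQ by auto
  qed simp
qed

lemma paired_card_le:
  assumes "Q \<subseteq> board n" "paired Q"
  shows "even (card Q)" "card Q \<le> 2 * (2 * n div 3)"
proof -
  have "finite Q" using assms(1) finite_subset[of Q "board n"] by (simp add: board_def)
  note c = paired_lines_count[OF this assms(2)]
  have "card (fst ` Q) \<le> card {1..int n}" "card (snd ` Q) \<le> card {1..int n}"
    using assms(1) by (intro card_mono; force simp: board_def)+
  then have "3 * card Q \<le> 4 * n" using c by simp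
  moreover obtain k where "card Q = 2 * k" using c by (elim conjE evenE)
  ultimately show "even (card Q)" "card Q \<le> 2 * (2 * n div 3)" by auto
qed

section \<open>The boards of sizes 3 and 5\<close>

text \<open>The counting bound allows two pairs on the board of size 3 and three pairs on the board of
  size 5. Neither exists, which a small exhaustive search shows.\<close>

lemma aligned_code [code]:
  "aligned (a, b) (c, d) \<longleftrightarrow>
     (if a = c then b \<noteq> d else b = d \<or> a - b = c - d \<or> a + b = c + d)"
  by (auto simp: aligned_def)

text \<open>The search takes the first remaining cell \<open>p\<close> and either leaves it empty or matches it
  with a later aligned cell \<open>q\<close>; in the second case all cells aligned with \<open>p\<close> or \<open>q\<close> become
  unusable, so very few cells survive. The functions are first order, since the evaluation by
  rewriting would also unfold calls below a \<open>\<lambda>\<close>.\<close>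

fun unaligned_with :: "cell \<Rightarrow> cell \<Rightarrow> cell list \<Rightarrow> cell list" where
  "unaligned_with p q [] = []"
| "unaligned_with p q (x # xs) =
     (if aligned p x \<or> aligned q x then unaligned_with p q xs else x # unaligned_with p q xs)"

lemma set_unaligned_with:
  "set (unaligned_with p q xs) = {x \<in> set xs. \<not> aligned p x \<and> \<not> aligned q x}"
  by (induction xs) auto

function pairs_fit :: "nat \<Rightarrow> cell list \<Rightarrow> bool"
  and partner_fits :: "nat \<Rightarrow> cell \<Rightarrow> cell list \<Rightarrow> cell list \<Rightarrow> bool" where
  "pairs_fit 0 cs = True"
| "pairs_fit (Suc k) [] = False"
| "pairs_fit (Suc k) (p # cs) = (pairs_fit (Suc k) cs \<or> partner_fits k p cs cs)"
| "partner_fits k p cs [] = False"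
| "partner_fits k p cs (q # qs) =
     (aligned p q \<and> pairs_fit k (unaligned_with p q cs) \<or> partner_fits k p cs qs)"
  by pat_completeness auto
termination
  by (relation "inv_image (less_than <*lex*> less_than)
       (case_sum (\<lambda>(k, cs). (2 * k, length cs)) (\<lambda>(k, p, cs, qs). (2 * k + 1, length qs)))") auto

lemma partner_fitsI:
  "q \<in> set qs \<Longrightarrow> aligned p q \<Longrightarrow> pairs_fit k (unaligned_with p q cs) \<Longrightarrow> partner_fits k p cs qs"
  by (induction qs) auto

lemma pairs_fit_complete:
  assumes "paired Q" "Q \<subseteq> set cs" "card Q = 2 * k"
  shows "pairs_fit k cs"
  using assms
proof (induction k arbitrary: Q cs)
  case (Suc k)
  from Suc.prems show ?case
  proof (induction cs)
    case (Cons p cs)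
    have fin: "finite Q" using Cons.prems(2) finite_subset by blast
    show ?case
    proof (cases "p \<in> Q")
      case False
      then have "pairs_fit (Suc k) cs" using Cons by (intro Cons.IH) auto
      then show ?thesis by simp
    next
      case True
      then obtain q where q: "q \<in> Q" "aligned p q" using Cons.prems(1) unfolding paired_def by blast
      then have pq: "p \<noteq> q" by (simp add: aligned_def)
      note rem = paired_remove_pair[OF Cons.prems(1) True q]
      have "card (Q - {p, q}) = 2 * k"
        using Cons.prems(3) True q(1) pq fin by (simp add: card_Diff_subset)
      moreover have "Q - {p, q} \<subseteq> set (unaligned_with p q cs)"
        using rem(2) Cons.prems(2) by (auto simp: set_unaligned_with)
      ultimately have "pairs_fit k (unaligned_with p q cs)" using Suc.IH rem(1) by blast
      moreover have "q \<in> set cs" using q(1) Cons.prems(2) pq by auto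
      ultimately show ?thesis using partner_fitsI q(2) by simp
    qed
  qed simp
qed simp

definition cells :: "nat \<Rightarrow> cell list" where
  "cells n = List.product [1..int n] [1..int n]"

lemma set_cells: "set (cells n) = board n"
  by (auto simp: cells_def board_def)

lemma no_two_pairs_3: "\<not> pairs_fit 2 (cells 3)"
  by code_simp

lemma no_three_pairs_5: "\<not> pairs_fit 3 (cells 5)"
  by code_simp

section \<open>Sum and product of placements\<close>

text \<open>The cells with difference close to \<open>0\<close> form a band around the main diagonal. Placements
  that avoid the band can be joined with placements that stay inside it, so both distances to
  the diagonal are tracked.\<close>

definition optimal_in_band :: "nat \<Rightarrow> int \<Rightarrow> int \<Rightarrow> bool" where
  "optimal_in_band n l h \<longleftrightarrow>
     (\<exists>Q. Q \<subseteq> board n \<and> paired Q \<and> card Q = 2 * (2 * n div 3) \<and>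
        (\<forall>(r, c)\<in>Q. l \<le> \<bar>c - r\<bar> \<and> \<bar>c - r\<bar> \<le> h))"

lemma optimal_in_band_mono:
  "optimal_in_band n l h \<Longrightarrow> l' \<le> l \<Longrightarrow> h \<le> h' \<Longrightarrow> optimal_in_band n l' h'"
  unfolding optimal_in_band_def by fastforce

lemma paired_Un:
  assumes "paired A" "paired B" "\<And>a b. a \<in> A \<Longrightarrow> b \<in> B \<Longrightarrow> \<not> aligned a b"
  shows "paired (A \<union> B)"
  unfolding paired_def
proof
  fix p assume "p \<in> A \<union> B"
  then show "\<exists>!q. q \<in> A \<union> B \<and> aligned p q"
  proof
    assume p: "p \<in> A"
    then have "q \<in> A \<union> B \<and> aligned p q \<longleftrightarrow> q \<in> A \<and> aligned p q" for q using assms(3) by blast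
    then show ?thesis using assms(1) p unfolding paired_def by simp
  next
    assume p: "p \<in> B"
    then have "q \<in> A \<union> B \<and> aligned p q \<longleftrightarrow> q \<in> B \<and> aligned p q" for q
      using assms(3) aligned_sym by blast
    then show ?thesis using assms(2) p unfolding paired_def by simp
  qed
qed

lemma paired_pair: "aligned p q \<Longrightarrow> paired {p, q}"
  unfolding paired_def using aligned_sym by (auto simp: aligned_def)

lemma aligned_translate:
  "aligned (r + k, c + k) (r' + k, c' + k) \<longleftrightarrow> aligned (r, c) (r', c')"
  by (auto simp: aligned_def)

text \<open>Put the second placement on the square block that follows the first board along the main
  diagonal. The two parts use different rows and columns, the sums of the coordinates are at
  most \<open>2 n\<close> in the first and at least \<open>2 n + 2\<close> in the second, and the differences are kept
  apart by the band. As \<open>3\<close> divides \<open>n\<close>, the rounding in \<open>2 n div 3\<close> is not affected and the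
  optimal numbers add up.\<close>

lemma optimal_in_band_sum:
  assumes "optimal_in_band n l h" "optimal_in_band m l' h'" "3 dvd n" "h' < l"
  shows "optimal_in_band (n + m) (min l l') (max h h')"
proof -
  obtain A where A: "A \<subseteq> board n" "paired A" "card A = 2 * (2 * n div 3)"
      "\<And>r c. (r, c) \<in> A \<Longrightarrow> l \<le> \<bar>c - r\<bar> \<and> \<bar>c - r\<bar> \<le> h"
    using assms(1) unfolding optimal_in_band_def by blast
  obtain B where B: "B \<subseteq> board m" "paired B" "card B = 2 * (2 * m div 3)"
      "\<And>r c. (r, c) \<in> B \<Longrightarrow> l' \<le> \<bar>c - r\<bar> \<and> \<bar>c - r\<bar> \<le> h'"
    using assms(2) unfolding optimal_in_band_def by blast
  define t :: "cell \<Rightarrow> cell" where "t = (\<lambda>(r, c). (r + int n, c + int n))"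
  have t: "inj t" "\<And>p q. aligned (t p) (t q) \<longleftrightarrow> aligned p q"
    by (auto simp: t_def inj_on_def aligned_translate)
  have tB: "int n < r \<and> int n < c \<and> r \<le> int (n + m) \<and> c \<le> int (n + m) \<and>
      l' \<le> \<bar>c - r\<bar> \<and> \<bar>c - r\<bar> \<le> h'" if "(r, c) \<in> t ` B" for r c
    using that B(1) B(4) by (fastforce simp: t_def board_def)
  have tA: "1 \<le> r \<and> 1 \<le> c \<and> r \<le> int n \<and> c \<le> int n" if "(r, c) \<in> A" for r c
    using that A(1) by (auto simp: board_def)
  have "paired (t ` B)"
    unfolding paired_def
  proof (intro ballI)
    fix p assume "p \<in> t ` B"
    then obtain b where b: "p = t b" "b \<in> B" by blast
    then obtain q where q: "q \<in> B" "aligned b q" "\<And>x. x \<in> B \<Longrightarrow> aligned b x \<Longrightarrow> x = q"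
      using B(2) unfolding paired_def by blast
    show "\<exists>!q. q \<in> t ` B \<and> aligned p q"
    proof (rule ex1I[of _ "t q"])
      show "t q \<in> t ` B \<and> aligned p (t q)" using q(1,2) b(1) t(2) by simp
      fix z assume z: "z \<in> t ` B \<and> aligned p z"
      then obtain x where "x \<in> B" "z = t x" by blast
      then show "z = t q" using z b(1) t(2) q(3) by simp
    qed
  qed
  moreover have "\<not> aligned a b" if "a \<in> A" "b \<in> t ` B" for a b
  proof -
    obtain r c r' c' where "a = (r, c)" "b = (r', c')" by (cases a; cases b)
    then show ?thesis using tA[of r c] tB[of r' c'] A(4)[of r c] that assms(4)
      by (auto simp: aligned_def)
  qed
  ultimately have "paired (A \<union> t ` B)" using A(2) paired_Un by blast
  moreover have "A \<union> t ` B \<subseteq> board (n + m)"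
    using tA tB unfolding board_def by fastforce
  moreover have "card (A \<union> t ` B) = 2 * (2 * (n + m) div 3)"
  proof -
    have "finite A" "finite (t ` B)"
      using A(1) B(1) finite_subset[of _ "board _"] by (auto simp: board_def)
    moreover have "A \<inter> t ` B = {}" using tA tB by fastforce
    moreover have "card (t ` B) = card B" using t(1) by (simp add: card_image inj_on_subset)
    moreover obtain k where "n = 3 * k" using assms(3) by blast
    moreover have "2 * (3 * k + m) div 3 = 2 * k + 2 * m div 3" for k by presburger
    ultimately show ?thesis using A(3) B(3) by (simp add: card_Un_disjoint)
  qed
  ultimately show ?thesis
    unfolding optimal_in_band_def using A(4) tB by (intro exI[of _ "A \<union> t ` B"]) fastforce
qed

text \<open>Read modulo \<open>q\<close>, the equation determines \<open>x\<close>, because \<open>k\<close> is a unit.\<close>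

lemma eq_of_digits_eq:
  fixes q k a a' x x' :: int
  assumes "coprime k q" "0 \<le> x" "x < q" "0 \<le> x'" "x' < q"
    and "q * a + k * x = q * a' + k * x'"
  shows "x = x'"
proof -
  have "k * (x - x') = q * (a' - a)" using assms(6) by (simp add: algebra_simps)
  then have "q dvd k * (x - x')" by simp
  then have "q dvd x - x'" using assms(1) by (simp add: coprime_commute coprime_dvd_mult_right_iff)
  moreover have "\<bar>x - x'\<bar> < q" using assms by linarith
  ultimately show ?thesis using zdvd_not_zless[of "\<bar>x - x'\<bar>" q] by fastforce
qed

text \<open>Replace every queen by a copy of the toroidal solution \<open>{(x, 2 x mod q). 0 \<le> x < q}\<close> of
  the classical \<open>q\<close> queens problem, and every empty cell by an empty \<open>q \<times> q\<close> block. Row, column,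
  difference and sum of a new queen are congruent modulo \<open>q\<close> to \<open>x\<close>, \<open>2 x\<close>, \<open>x\<close> and \<open>3 x\<close> up to
  constants. As \<open>q\<close> is coprime to \<open>6\<close>, a common line forces the same \<open>x\<close>, and then the old
  queens are aligned. The differences inside a block range from \<open>- (q div 2)\<close> to \<open>q div 2\<close>, so
  the relative width of the band hardly changes.\<close>

lemma optimal_in_band_product:
  assumes "optimal_in_band n l h" "3 dvd n" "q mod 6 = 1 \<or> q mod 6 = 5"
  shows "optimal_in_band (q * n) (int q * l - int (q div 2)) (int q * h + int (q div 2))"
proof -
  define s where "s = q div 2"
  obtain A where A: "A \<subseteq> board n" "paired A" "card A = 2 * (2 * n div 3)"
      "\<And>r c. (r, c) \<in> A \<Longrightarrow> l \<le> \<bar>c - r\<bar> \<and> \<bar>c - r\<bar> \<le> h"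
    using assms(1) unfolding optimal_in_band_def by blast
  define Q S where "Q = int q" and "S = int s"
  have "odd q" using assms(3) by presburger
  then have q: "q = 2 * s + 1" by (simp add: s_def)
  then have QS: "Q = 2 * S + 1" "0 \<le> S" by (auto simp: Q_def S_def)
  have cop: "coprime (1::int) Q" "coprime 2 Q" "coprime 3 Q"
  proof -
    have "odd Q" "Q mod 3 = 1 \<or> Q mod 3 = 2" using assms(3) unfolding Q_def by presburger+
    moreover have "coprime 2 (3::int)" by (simp add: coprime_left_2_iff_odd)
    ultimately have "coprime (Q mod 3) 3" by (metis coprime_1_left)
    then have "coprime Q 3" by simp
    then show "coprime 2 Q" "coprime 3 Q"
      using \<open>odd Q\<close> by (simp_all add: coprime_left_2_iff_odd coprime_commute)
  qed simp
  \<comment> \<open>\<open>2 * x - Q * w x\<close> is \<open>2 * x mod Q\<close>, written so that it stays piecewise linear in \<open>x\<close>.\<close>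
  define w where "w x = (if x \<le> S then 0 else 1::int)" for x :: int
  define f :: "cell \<times> int \<Rightarrow> cell" where
    "f = (\<lambda>((r, c), x). (Q * r - 2 * S + x, Q * c - 2 * S + 2 * x - Q * w x))"
  let ?X = "{0..2 * S}"
  \<comment> \<open>\<open>k\<close> is the coefficient of \<open>x\<close> in the kind of line (row 1, column 2, difference 1, sum 3), and \<open>e\<close> tells whether
    the column, hence the reduction modulo \<open>Q\<close>, enters.\<close>
  have digit: "x = x' \<and> a = a'"
    if "x \<in> ?X" "x' \<in> ?X" "coprime k Q"
      "Q * a + k * x - Q * e * w x = Q * a' + k * x' - Q * e * w x'" for k x x' a a' e :: int
  proof -
    have "Q * (a - e * w x) + k * x = Q * (a' - e * w x') + k * x'"
      using that(4) by (simp add: algebra_simps)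
    then have "x = x'" using eq_of_digits_eq[OF that(3)] that(1,2) QS(1) by auto
    then show ?thesis using that(4) QS by auto
  qed
  have row: "x = x' \<and> r = r'" if "x \<in> ?X" "x' \<in> ?X" "fst (f ((r, c), x)) = fst (f ((r', c'), x'))"
    for r c r' c' x x'
    using digit[OF that(1,2) cop(1), of r 0 r'] that(3) by (simp add: f_def)
  have col: "x = x' \<and> c = c'" if "x \<in> ?X" "x' \<in> ?X" "snd (f ((r, c), x)) = snd (f ((r', c'), x'))"
    for r c r' c' x x'
    using digit[OF that(1,2) cop(2), of c 1 c'] that(3) by (simp add: f_def)
  have diff: "x = x' \<and> c - r = c' - r'" if "x \<in> ?X" "x' \<in> ?X"
      "fst (f ((r, c), x)) - snd (f ((r, c), x)) = fst (f ((r', c'), x')) - snd (f ((r', c'), x'))"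
    for r c r' c' x x'
    using digit[OF that(1,2) cop(1), of "c - r" 1 "c' - r'"] that(3) by (simp add: f_def algebra_simps)
  have sum: "x = x' \<and> r + c = r' + c'" if "x \<in> ?X" "x' \<in> ?X"
      "fst (f ((r, c), x)) + snd (f ((r, c), x)) = fst (f ((r', c'), x')) + snd (f ((r', c'), x'))"
    for r c r' c' x x'
    using digit[OF that(1,2) cop(3), of "r + c" 1 "r' + c'"] that(3) by (simp add: f_def algebra_simps)
  have inj: "inj_on f (A \<times> ?X)"
  proof (rule inj_onI)
    fix u v assume uv: "u \<in> A \<times> ?X" "v \<in> A \<times> ?X" "f u = f v"
    obtain r c x r' c' x' where "u = ((r, c), x)" "v = ((r', c'), x')" by (metis prod.exhaust)
    then show "u = v" using uv row[of x x' r c r' c'] col[of x x' r c r' c'] by auto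
  qed
  have al: "aligned (f (p, x)) (f (p', x')) \<longleftrightarrow> x = x' \<and> aligned p p'"
    if "x \<in> ?X" "x' \<in> ?X" for p p' x x'
  proof -
    obtain r c r' c' where p: "p = (r, c)" "p' = (r', c')" by (cases p; cases p')
    show ?thesis
    proof
      assume a: "aligned (f (p, x)) (f (p', x'))"
      then have "p \<noteq> p' \<or> x \<noteq> x'" by (auto simp: aligned_def)
      with a show "x = x' \<and> aligned p p'"
        using row[OF that] col[OF that] diff[OF that] sum[OF that]
        unfolding aligned_def p by (smt (verit) fst_conv snd_conv)
    next
      assume a: "x = x' \<and> aligned p p'"
      have "f (p, x) \<noteq> f (p', x')"
        using row[OF that, of r c r' c'] col[OF that, of r c r' c'] a p by (auto simp: aligned_def)
      moreover have "Q * c - Q * r = Q * c' - Q * r'" if "c - r = c' - r'"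
        using that by (metis right_diff_distrib)
      moreover have "Q * r + Q * c = Q * r' + Q * c'" if "r + c = r' + c'"
        using that by (metis distrib_left)
      ultimately show "aligned (f (p, x)) (f (p', x'))"
        using a unfolding p aligned_def f_def by auto
    qed
  qed
  have "paired (f ` (A \<times> ?X))"
    unfolding paired_def
  proof (intro ballI)
    fix y assume "y \<in> f ` (A \<times> ?X)"
    then obtain p x where p: "p \<in> A" "x \<in> ?X" "y = f (p, x)" by blast
    then obtain p' where p': "p' \<in> A" "aligned p p'" "\<And>z. z \<in> A \<Longrightarrow> aligned p z \<Longrightarrow> z = p'"
      using A(2) unfolding paired_def by blast
    show "\<exists>!z. z \<in> f ` (A \<times> ?X) \<and> aligned y z"
    proof (rule ex1I[of _ "f (p', x)"])
      show "f (p', x) \<in> f ` (A \<times> ?X) \<and> aligned y (f (p', x))" using p p' al by blast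
      fix z assume z: "z \<in> f ` (A \<times> ?X) \<and> aligned y z"
      then obtain p'' x'' where "p'' \<in> A" "x'' \<in> ?X" "z = f (p'', x'')" by blast
      then show "z = f (p', x)" using z p p'(3) al by metis
    qed
  qed
  moreover have band: "1 \<le> r' \<and> r' \<le> Q * int n \<and> 1 \<le> c' \<and> c' \<le> Q * int n \<and>
      Q * l - S \<le> \<bar>c' - r'\<bar> \<and> \<bar>c' - r'\<bar> \<le> Q * h + S" if mem: "(r', c') \<in> f ` (A \<times> ?X)" for r' c'
  proof -
    obtain r c x where rc: "(r, c) \<in> A" "x \<in> ?X"
        "r' = Q * r - 2 * S + x" "c' = Q * c - 2 * S + 2 * x - Q * w x"
      using mem by (auto simp: f_def)
    have "1 \<le> r" "r \<le> int n" "1 \<le> c" "c \<le> int n" using A(1) rc(1) by (auto simp: board_def)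
    then have blk: "Q * 1 \<le> Q * r" "Q * r \<le> Q * int n" "Q * 1 \<le> Q * c" "Q * c \<le> Q * int n"
      using QS by (auto intro!: mult_left_mono)
    define y where "y = 2 * x - Q * w x"
    have x: "0 \<le> x" "x \<le> 2 * S" using rc(2) by auto
    have y: "0 \<le> y" "y \<le> 2 * S" "\<bar>y - x\<bar> \<le> S"
      using rc(2) QS by (auto simp: w_def y_def)
    have "1 \<le> r' \<and> r' \<le> Q * int n \<and> 1 \<le> c' \<and> c' \<le> Q * int n"
      using blk x y(1,2) y_def rc(3,4) QS(1) by (intro conjI; linarith)
    moreover have "c' - r' = Q * (c - r) + (y - x)" using rc(3,4) by (simp add: y_def algebra_simps)
    moreover have "Q * l \<le> \<bar>Q * (c - r)\<bar>" "\<bar>Q * (c - r)\<bar> \<le> Q * h"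
      using A(4)[OF rc(1)] QS by (simp_all add: abs_mult)
    moreover have "\<bar>a\<bar> - \<bar>b\<bar> \<le> \<bar>a + b\<bar>" "\<bar>a + b\<bar> \<le> \<bar>a\<bar> + \<bar>b\<bar>" for a b :: int by arith+
    ultimately show ?thesis using y(3) by (smt (verit))
  qed
  moreover have "card (f ` (A \<times> ?X)) = 2 * (2 * (q * n) div 3)"
  proof -
    obtain k where k: "n = 3 * k" using assms(2) by blast
    have "nat (2 * S + 1) = q" using q by (simp add: S_def)
    then have "card (f ` (A \<times> ?X)) = card A * q" using inj by (simp add: card_image card_cartesian_product)
    also have "\<dots> = 2 * (2 * (q * n) div 3)" using A(3) by (simp add: k)
    finally show ?thesis .
  qed
  moreover have "f ` (A \<times> ?X) \<subseteq> board (q * n)"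
  proof
    fix y assume "y \<in> f ` (A \<times> ?X)"
    then show "y \<in> board (q * n)"
      using band[of "fst y" "snd y"] by (simp add: board_def Q_def mem_Times_iff)
  qed
  moreover have "\<forall>(r, c)\<in>f ` (A \<times> ?X).
      int q * l - int s \<le> \<bar>c - r\<bar> \<and> \<bar>c - r\<bar> \<le> int q * h + int s"
    unfolding split_beta
  proof
    fix y assume "y \<in> f ` (A \<times> ?X)"
    then show "int q * l - int s \<le> \<bar>snd y - fst y\<bar> \<and> \<bar>snd y - fst y\<bar> \<le> int q * h + int s"
      using band[of "fst y" "snd y"] by (simp add: Q_def S_def)
  qed
  ultimately show ?thesis unfolding optimal_in_band_def s_def by blast
qed

section \<open>Explicit placements\<close>

fun separated_pairs :: "(cell \<times> cell) list \<Rightarrow> bool" where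
  "separated_pairs [] = True"
| "separated_pairs ((p, q) # ps) =
     (aligned p q \<and>
      list_all (\<lambda>(x, y). \<not> aligned p x \<and> \<not> aligned p y \<and> \<not> aligned q x \<and> \<not> aligned q y) ps \<and>
      separated_pairs ps)"

text \<open>Explicit placements are given by triples: a row and the two columns of its pair, or a
  column and the two rows of its pair.\<close>

definition row_pairs :: "(int \<times> int \<times> int) list \<Rightarrow> (cell \<times> cell) list" where
  "row_pairs = map (\<lambda>(r, c, c'). ((r, c), (r, c')))"

definition col_pairs :: "(int \<times> int \<times> int) list \<Rightarrow> (cell \<times> cell) list" where
  "col_pairs = map (\<lambda>(c, r, r'). ((r, c), (r', c)))"

lemma optimal_in_band_of_pairs:
  assumes "separated_pairs ps" "length ps = 2 * n div 3"
    and "list_all (\<lambda>(p, q). list_all (\<lambda>(r, c). 1 \<le> r \<and> r \<le> int n \<and> 1 \<le> c \<and> c \<le> int n \<and>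
           l \<le> \<bar>c - r\<bar> \<and> \<bar>c - r\<bar> \<le> h) [p, q]) ps"
  shows "optimal_in_band n l h"
proof -
  have "paired (\<Union>(p, q)\<in>set ps. {p, q}) \<and> card (\<Union>(p, q)\<in>set ps. {p, q}) = 2 * length ps"
    using assms(1)
  proof (induction ps rule: separated_pairs.induct)
    case (2 p q ps)
    let ?B = "\<Union>(p, q)\<in>set ps. {p, q}"
    have sep: "aligned p q" "\<And>b. b \<in> ?B \<Longrightarrow> \<not> aligned p b \<and> \<not> aligned q b"
      using 2(2) by (auto simp: list_all_iff)
    have "p \<notin> ?B"
      using sep(2)[of p] sep(1) aligned_sym by blast
    moreover have "q \<notin> ?B"
      using sep(2)[of q] sep(1) aligned_sym by blast
    moreover have "p \<noteq> q" using sep(1) by (simp add: aligned_def)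
    moreover have "finite ?B" by auto
    ultimately have "card ({p, q} \<union> ?B) = 2 + card ?B" by simp
    moreover have "paired ({p, q} \<union> ?B)"
      by (rule paired_Un) (use 2 sep paired_pair in auto)
    moreover have "(\<Union>(p, q)\<in>set ((p, q) # ps). {p, q}) = {p, q} \<union> ?B" by auto
    ultimately show ?case using 2 by simp
  qed (simp add: paired_def)
  then show ?thesis
    unfolding optimal_in_band_def using assms(2,3)
    by (intro exI[of _ "\<Union>(p, q)\<in>set ps. {p, q}"]) (fastforce simp: list_all_iff board_def)
qed

text \<open>The following placements were found by a randomised computer search. The lower bound of
  the band matters where a placement is enlarged or receives another one in its corner; the
  upper bound matters for sizes 2, 6, 9, 11 and 12, which are placed into the corners of others.\<close>

lemma optimal_in_band_0: "optimal_in_band 0 0 0"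
  by (rule optimal_in_band_of_pairs[of "[]"]) code_simp+

lemma optimal_in_band_1: "optimal_in_band 1 0 (-1)"
  by (rule optimal_in_band_of_pairs[of "[]"]) code_simp+

lemma optimal_in_band_2: "optimal_in_band 2 0 0"
  by (rule optimal_in_band_of_pairs[of "[((1, 1), (2, 2))]"]) code_simp+

lemma optimal_in_band_4: "optimal_in_band 4 0 1"
  by (rule optimal_in_band_of_pairs[of "[((1, 1), (2, 2)), ((3, 4), (4, 3))]"]) code_simp+

lemma optimal_in_band_6: "optimal_in_band 6 1 4"
  by (rule optimal_in_band_of_pairs[of "row_pairs
      [(1, 2, 3), (6, 4, 5)] @ col_pairs
      [(1, 4, 5), (6, 2, 3)]"])
    code_simp+

lemma optimal_in_band_9: "optimal_in_band 9 0 7"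
  by (rule optimal_in_band_of_pairs[of "row_pairs
      [(3, 2, 3), (6, 1, 4), (9, 5, 6)] @ col_pairs
      [(7, 1, 2), (8, 4, 5), (9, 7, 8)]"])
    code_simp+

lemma optimal_in_band_11: "optimal_in_band 11 0 7"
  by (rule optimal_in_band_of_pairs[of "row_pairs
      [(1, 5, 6), (4, 1, 7), (9, 3, 8), (11, 4, 9)] @ col_pairs
      [(2, 2, 6), (10, 3, 8), (11, 5, 10)]"])
    code_simp+

lemma optimal_in_band_12: "optimal_in_band 12 2 9"
  by (rule optimal_in_band_of_pairs[of "row_pairs
      [(1, 4, 6), (2, 8, 10), (11, 3, 5), (12, 7, 9)] @ col_pairs
      [(1, 8, 10), (2, 4, 6), (11, 7, 9), (12, 3, 5)]"])
    code_simp+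

lemma optimal_in_band_15: "optimal_in_band 15 2 13"
  by (rule optimal_in_band_of_pairs[of "row_pairs
      [(1, 4, 6), (3, 5, 13), (4, 8, 11), (13, 9, 10), (14, 7, 12)] @ col_pairs
      [(1, 10, 12), (2, 7, 8), (3, 11, 15), (14, 5, 6), (15, 2, 9)]"])
    code_simp+

lemma optimal_in_band_18: "optimal_in_band 18 2 17"
  by (rule optimal_in_band_of_pairs[of "row_pairs
      [(1, 10, 12), (4, 8, 14), (5, 3, 11), (15, 5, 7), (17, 6, 13), (18, 9, 15)] @ col_pairs
      [(1, 13, 16), (2, 7, 8), (4, 2, 11), (16, 3, 9), (17, 12, 14), (18, 6, 10)]"])
    code_simp+

lemma optimal_in_band_21: "optimal_in_band 21 2 20"
  by (rule optimal_in_band_of_pairs[of "row_pairs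
      [(1, 3, 12), (2, 17, 19), (3, 8, 9), (4, 11, 18), (17, 6, 15), (20, 13, 16), (21, 5, 7)] @ col_pairs
      [(1, 13, 16), (2, 5, 8), (4, 12, 14), (10, 15, 19), (14, 6, 10), (20, 7, 11), (21, 9, 18)]"])
    code_simp+

lemma optimal_in_band_24: "optimal_in_band 24 2 23"
  by (rule optimal_in_band_of_pairs[of "row_pairs
      [(1, 5, 17), (2, 7, 10), (4, 13, 16), (15, 9, 11), (21, 6, 8), (22, 19, 20),
       (23, 14, 15), (24, 4, 12)] @ col_pairs
      [(1, 6, 18), (2, 12, 13), (3, 10, 19), (18, 5, 16), (21, 11, 14), (22, 3, 8),
       (23, 17, 20), (24, 7, 9)]"])
    code_simp+

lemma optimal_in_band_27: "optimal_in_band 27 2 26"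
  by (rule optimal_in_band_of_pairs[of "row_pairs
      [(1, 9, 18), (2, 6, 22), (5, 17, 27), (7, 10, 23), (23, 8, 12), (24, 14, 20),
       (25, 3, 16), (26, 13, 21), (27, 7, 15)] @ col_pairs
      [(1, 20, 22), (2, 4, 16), (4, 10, 12), (5, 8, 21), (11, 9, 18), (19, 6, 14), (24, 3, 13),
       (25, 11, 15), (26, 17, 19)]"])
    code_simp+

lemma optimal_in_band_33: "optimal_in_band 33 1 32"
  by (rule optimal_in_band_of_pairs[of "row_pairs
      [(1, 9, 25), (2, 15, 23), (4, 18, 26), (5, 4, 28), (6, 10, 22), (10, 21, 29),
       (18, 14, 27), (23, 17, 20), (28, 8, 13), (32, 16, 24), (33, 11, 19)] @ col_pairs
      [(1, 12, 19), (2, 21, 27), (3, 8, 15), (5, 7, 22), (6, 13, 29), (7, 17, 31), (12, 9, 25),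
       (30, 20, 24), (31, 3, 11), (32, 14, 30), (33, 16, 26)]"])
    code_simp+

lemma optimal_in_band_36: "optimal_in_band 36 1 35"
  by (rule optimal_in_band_of_pairs[of "row_pairs
      [(3, 20, 31), (4, 13, 18), (5, 10, 16), (8, 6, 12), (11, 21, 27), (17, 14, 29),
       (20, 5, 23), (29, 25, 36), (33, 11, 26), (34, 8, 15), (35, 17, 22), (36, 24, 28)] @ col_pairs
      [(1, 6, 25), (2, 22, 27), (3, 9, 30), (4, 14, 15), (7, 21, 23), (9, 7, 32), (19, 18, 28),
       (30, 10, 31), (32, 24, 26), (33, 2, 12), (34, 16, 19), (35, 1, 13)]"])
    code_simp+

lemma optimal_in_band_39: "optimal_in_band 39 1 38"
  by (rule optimal_in_band_of_pairs[of "row_pairs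
      [(1, 14, 16), (2, 19, 23), (3, 17, 34), (4, 28, 29), (5, 8, 24), (14, 10, 21),
       (26, 15, 32), (31, 22, 35), (33, 13, 31), (34, 9, 36), (37, 5, 11), (38, 25, 30),
       (39, 12, 20)] @ col_pairs
      [(1, 6, 17), (2, 12, 36), (3, 9, 20), (4, 27, 35), (6, 13, 24), (7, 19, 29),
       (18, 10, 32), (26, 8, 21), (27, 18, 30), (33, 7, 23), (37, 15, 25), (38, 11, 22),
       (39, 16, 28)]"])
    code_simp+

lemma optimal_in_band_45: "optimal_in_band 45 1 44"
  by (rule optimal_in_band_of_pairs[of "row_pairs
      [(1, 28, 30), (2, 25, 38), (3, 8, 19), (4, 16, 41), (5, 23, 44), (6, 9, 10), (7, 18, 32),
       (8, 6, 15), (13, 33, 35), (24, 17, 20), (33, 2, 27), (41, 14, 29), (43, 24, 26),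
       (44, 31, 34), (45, 11, 21)] @ col_pairs
      [(1, 23, 29), (3, 18, 39), (4, 15, 30), (5, 21, 28), (7, 10, 36), (12, 20, 26),
       (13, 34, 38), (22, 14, 40), (36, 17, 27), (37, 35, 42), (39, 11, 22), (40, 19, 25),
       (42, 16, 32), (43, 9, 37), (45, 12, 31)]"])
    code_simp+

lemma optimal_in_band_48: "optimal_in_band 48 1 47"
  by (rule optimal_in_band_of_pairs[of "row_pairs
      [(1, 10, 38), (2, 29, 34), (3, 16, 37), (4, 12, 43), (7, 3, 28), (8, 15, 33),
       (9, 20, 23), (12, 9, 40), (30, 32, 48), (33, 1, 5), (34, 22, 27), (38, 11, 30),
       (39, 14, 25), (44, 13, 21), (45, 6, 35), (46, 24, 31)] @ col_pairs
      [(2, 15, 28), (4, 21, 22), (7, 13, 26), (8, 37, 42), (17, 5, 11), (18, 19, 48),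
       (19, 24, 35), (26, 16, 47), (36, 10, 31), (39, 20, 36), (41, 40, 43), (42, 6, 18),
       (44, 14, 27), (45, 29, 41), (46, 17, 23), (47, 25, 32)]"])
    code_simp+

lemma optimal_in_band_51: "optimal_in_band 51 1 50"
  by (rule optimal_in_band_of_pairs[of "row_pairs
      [(3, 14, 26), (4, 12, 31), (5, 10, 39), (6, 16, 28), (7, 25, 38), (8, 20, 32),
       (12, 19, 37), (28, 23, 30), (30, 17, 46), (40, 8, 41), (44, 6, 47), (45, 27, 43),
       (46, 22, 34), (48, 18, 29), (49, 21, 40), (50, 7, 15), (51, 24, 48)] @ col_pairs
      [(1, 37, 38), (2, 19, 25), (3, 17, 43), (4, 15, 26), (5, 21, 36), (9, 16, 24),
       (11, 2, 32), (13, 23, 47), (33, 20, 34), (35, 29, 39), (36, 1, 42), (42, 14, 27),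
       (44, 11, 18), (45, 9, 41), (49, 10, 35), (50, 13, 33), (51, 22, 31)]"])
    code_simp+

lemma optimal_in_band_54: "optimal_in_band 54 1 53"
  by (rule optimal_in_band_of_pairs[of "row_pairs
      [(2, 26, 34), (3, 19, 24), (4, 17, 33), (9, 6, 31), (15, 5, 43), (18, 16, 37),
       (26, 9, 21), (30, 11, 41), (31, 35, 39), (36, 7, 15), (38, 14, 30), (42, 44, 48),
       (47, 12, 40), (49, 23, 36), (50, 13, 32), (52, 27, 29), (53, 20, 25), (54, 10, 38)] @ col_pairs
      [(1, 28, 32), (2, 14, 43), (3, 23, 41), (4, 19, 34), (8, 40, 48), (18, 6, 24),
       (22, 8, 17), (28, 21, 37), (42, 11, 46), (45, 12, 35), (46, 29, 45), (47, 13, 20),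
       (49, 1, 5), (50, 27, 51), (51, 25, 33), (52, 10, 22), (53, 16, 44), (54, 7, 39)]"])
    code_simp+

lemma optimal_in_band_57: "optimal_in_band 57 1 56"
  by (rule optimal_in_band_of_pairs[of "row_pairs
      [(2, 6, 28), (3, 11, 19), (4, 25, 52), (6, 12, 40), (7, 10, 26), (9, 29, 36),
       (13, 15, 18), (14, 7, 45), (19, 34, 54), (31, 20, 30), (37, 4, 47), (43, 22, 35),
       (46, 17, 24), (47, 3, 42), (50, 37, 44), (52, 38, 49), (53, 16, 33), (55, 27, 53),
       (56, 39, 46)] @ col_pairs
      [(1, 24, 26), (2, 34, 38), (5, 21, 32), (8, 12, 27), (9, 49, 51), (13, 44, 54),
       (14, 29, 48), (21, 33, 45), (23, 11, 41), (31, 8, 17), (32, 10, 15), (41, 30, 40),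
       (43, 1, 36), (48, 35, 57), (50, 5, 18), (51, 23, 42), (55, 22, 25), (56, 16, 20),
       (57, 28, 39)]"])
    code_simp+

lemma optimal_in_band_63: "optimal_in_band 63 1 62"
  by (rule optimal_in_band_of_pairs[of "row_pairs
      [(1, 28, 39), (2, 17, 41), (3, 23, 33), (4, 27, 53), (5, 16, 40), (7, 51, 55),
       (12, 22, 37), (16, 25, 34), (33, 45, 47), (34, 5, 8), (40, 21, 26), (46, 43, 50),
       (49, 10, 18), (50, 13, 20), (54, 44, 59), (55, 31, 35), (57, 36, 48), (58, 14, 46),
       (59, 32, 57), (60, 19, 24), (61, 4, 56)] @ col_pairs
      [(1, 14, 29), (2, 36, 45), (3, 10, 53), (6, 38, 62), (7, 18, 30), (9, 13, 51),
       (11, 9, 17), (12, 20, 52), (15, 31, 37), (29, 22, 26), (30, 24, 47), (38, 56, 63),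
       (42, 6, 43), (49, 25, 48), (52, 23, 35), (54, 28, 41), (58, 11, 42), (60, 32, 39),
       (61, 15, 27), (62, 19, 21), (63, 8, 44)]"])
    code_simp+

lemma optimal_in_band_87: "optimal_in_band 87 1 86"
  by (rule optimal_in_band_of_pairs[of "row_pairs
      [(4, 3, 27), (5, 33, 60), (7, 56, 66), (9, 34, 59), (10, 16, 45), (12, 28, 29),
       (14, 40, 44), (17, 30, 69), (22, 65, 79), (24, 26, 72), (26, 46, 63), (27, 35, 61),
       (31, 15, 17), (44, 53, 68), (51, 49, 54), (56, 8, 51), (60, 32, 78), (66, 12, 43),
       (71, 10, 64), (72, 22, 55), (73, 31, 77), (77, 36, 41), (78, 38, 58), (79, 14, 23),
       (80, 37, 42), (82, 48, 50), (85, 39, 67), (86, 62, 75), (87, 19, 83)] @ col_pairs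
      [(1, 34, 65), (2, 28, 68), (4, 48, 63), (5, 20, 40), (6, 16, 18), (7, 46, 52),
       (9, 62, 81), (11, 33, 58), (13, 3, 19), (18, 39, 43), (20, 29, 57), (21, 2, 70),
       (24, 32, 75), (25, 54, 55), (47, 36, 74), (52, 8, 23), (57, 25, 76), (70, 6, 83),
       (71, 13, 49), (73, 1, 37), (74, 67, 69), (76, 38, 61), (80, 15, 35), (81, 30, 50),
       (82, 21, 41), (84, 42, 45), (85, 64, 84), (86, 53, 59), (87, 11, 47)]"])
    code_simp+

section \<open>Optimal placements of all sizes\<close>

text \<open>Sizes are grouped into \<open>3 k\<close>, \<open>3 k + 1\<close>, \<open>3 k + 2\<close>: adding a host board of size divisible
  by \<open>3\<close> carries a whole group to another group. Since the boards of sizes 3 and 5 have no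
  placement with \<open>2 (2 n div 3)\<close> queens, the group of \<open>3\<close> fails; that of \<open>0\<close> holds, with two
  queens on the diagonal of the board of size 2.\<close>

definition three_sizes :: "nat \<Rightarrow> int \<Rightarrow> bool" where
  "three_sizes m h \<longleftrightarrow> (\<forall>j<3. optimal_in_band (m + j) 0 h)"

lemma three_sizesI:
  assumes "optimal_in_band m 0 h" "optimal_in_band (m + 1) 0 h" "optimal_in_band (m + 2) 0 h"
  shows "three_sizes m h"
proof -
  have "j = 0 \<or> j = 1 \<or> j = 2" if "j < 3" for j :: nat using that by linarith
  then show ?thesis using assms unfolding three_sizes_def by (metis add.right_neutral)
qed

lemma three_sizes_0: "three_sizes 0 0"
  by (rule three_sizesI)
    (use optimal_in_band_0 optimal_in_band_mono[OF optimal_in_band_1, of 0 0] optimal_in_band_2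
      in \<open>simp_all add: numeral_2_eq_2\<close>)

text \<open>The basic step: enlarge a host placement of size \<open>n\<close> by the factor \<open>q\<close>, and put a board of
  size \<open>m + j\<close> in the corner, all of whose queens fit into the band that the host leaves free.\<close>

lemma three_sizes_sum:
  assumes "optimal_in_band n l h" "three_sizes m h'"
    and "3 dvd n" "q mod 6 = 1 \<or> q mod 6 = 5" "0 \<le> h'" "h' < int q * l - int (q div 2)"
  shows "three_sizes (q * n + m) (max (int q * h + int (q div 2)) h')"
  unfolding three_sizes_def
proof (intro allI impI)
  fix j :: nat assume "j < 3"
  then have "optimal_in_band (m + j) 0 h'" using assms(2) by (simp add: three_sizes_def)
  moreover have "optimal_in_band (q * n) (int q * l - int (q div 2)) (int q * h + int (q div 2))"
    by (rule optimal_in_band_product[OF assms(1,3,4)])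
  ultimately have "optimal_in_band (q * n + (m + j)) (min (int q * l - int (q div 2)) 0)
      (max (int q * h + int (q div 2)) h')"
    using assms(3,6) by (intro optimal_in_band_sum) auto
  then show "optimal_in_band (q * n + m + j) 0 (max (int q * h + int (q div 2)) h')"
    using assms(5,6) by (simp add: add.assoc min_absorb2)
qed

lemma three_sizes_6: "three_sizes 6 4"
  using three_sizes_sum[OF optimal_in_band_6 three_sizes_0, of 1] by simp

text \<open>The placement of size 9 leaves no free band, so the corner pair that leads from \<open>9\<close> to
  \<open>11\<close> does not fit, and size 11 needs a placement of its own.\<close>

lemma three_sizes_9: "three_sizes 9 7"
  by (rule three_sizesI)
    (use optimal_in_band_9 optimal_in_band_sum[OF optimal_in_band_9 optimal_in_band_1] optimal_in_band_11
      in simp_all)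

lemma three_sizes_12: "three_sizes 12 9"
  using three_sizes_sum[OF optimal_in_band_12 three_sizes_0, of 1] by simp

text \<open>On a board of size at most \<open>m + 2\<close> no difference exceeds \<open>m + 1\<close>.\<close>

lemma three_sizes_trivial_band:
  assumes "three_sizes m h"
  shows "three_sizes m (int m + 1)"
  unfolding three_sizes_def
proof (intro allI impI)
  fix j :: nat assume j: "j < 3"
  then obtain Q where Q: "Q \<subseteq> board (m + j)" "paired Q" "card Q = 2 * (2 * (m + j) div 3)"
    using assms unfolding three_sizes_def optimal_in_band_def by blast
  have "0 \<le> \<bar>c - r\<bar> \<and> \<bar>c - r\<bar> \<le> int m + 1" if "(r, c) \<in> Q" for r c
    using subsetD[OF Q(1) that] j by (auto simp: board_def)
  then show "optimal_in_band (m + j) 0 (int m + 1)" unfolding optimal_in_band_def using Q by blast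
qed

text \<open>The divisibility of \<open>N\<close> makes \<open>N\<close> itself the next size to be settled.\<close>

definition solved_below :: "nat \<Rightarrow> bool" where
  "solved_below N \<longleftrightarrow> 3 dvd N \<and> (\<forall>m. 3 dvd m \<longrightarrow> 6 \<le> m \<longrightarrow> m < N \<longrightarrow> three_sizes m (int m + 1))"

lemma solved_below_step:
  assumes "solved_below N" "three_sizes m h" "m = N" "N' = N + 3"
  shows "solved_below N'"
proof -
  have "m = N \<or> m < N" if "3 dvd m" "m < N + 3" for m
  proof -
    have "3 dvd N" using assms(1) by (simp add: solved_below_def)
    then show ?thesis using that by presburger
  qed
  then show ?thesis
    using assms three_sizes_trivial_band[OF assms(2)] unfolding solved_below_def by auto
qed

text \<open>With no knowledge about the corner placement except its size \<open>p\<close>, every \<open>p\<close> from \<open>6\<close> up to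
  the width of the band is admissible, so a single host settles an interval of sizes.\<close>

lemma solved_below_interval:
  assumes "solved_below N" "optimal_in_band n l h" "3 dvd n" "q mod 6 = 1 \<or> q mod 6 = 5"
    and "3 dvd N'" "q * n + 6 \<le> N" "N' < N + q * n + 3"
    and "int N' - int (q * n) - 2 < int q * l - int (q div 2)"
  shows "solved_below N'"
  unfolding solved_below_def
proof (intro conjI allI impI)
  fix m :: nat assume m: "3 dvd m" "6 \<le> m" "m < N'"
  show "three_sizes m (int m + 1)"
  proof (cases "m < N")
    case True
    then show ?thesis using assms(1) m by (simp add: solved_below_def)
  next
    case False
    define p where "p = m - q * n"
    have p: "m = q * n + p" "6 \<le> p" using False assms(6) by (auto simp: p_def)
    have "3 dvd p" using p(1) m(1) assms(3) by (metis dvd_add_right_iff dvd_mult)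
    moreover have "m + 3 \<le> N'" using m(1,3) assms(5) by presburger
    moreover from this have "p < N" using p(1) assms(7) by linarith
    moreover have "int p + 1 < int q * l - int (q div 2)"
      using assms(8) \<open>m + 3 \<le> N'\<close> p(1) by linarith
    ultimately have "three_sizes p (int p + 1)" "int p + 1 < int q * l - int (q div 2)"
      using assms(1) p(2) unfolding solved_below_def by blast+
    then have "three_sizes m (max (int q * h + int (q div 2)) (int p + 1))"
      unfolding p(1) using assms(2-4) by (intro three_sizes_sum) auto
    then show ?thesis by (rule three_sizes_trivial_band)
  qed
qed (rule assms(5))

text \<open>Apart from the group of \<open>9\<close>, each step decomposes a size into \<open>q * b + m\<close> with an explicit
  host of size \<open>b\<close>. While the bands are narrow, only the corner groups \<open>m = 0, 6, 9, 12\<close> of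
  known small width are used, one size at a time; wider bands settle intervals.\<close>

lemma solved_below_450: "solved_below 450"
proof -
  have "solved_below 6" by (simp add: solved_below_def)
  then have "solved_below 9"
    by (rule solved_below_step[OF _ three_sizes_sum[of 6 _ _ _ _ 1, OF optimal_in_band_6 three_sizes_0]]) simp_all
  then have "solved_below 12"
    by (rule solved_below_step[OF _ three_sizes_9]) simp_all
  then have "solved_below 15"
    by (rule solved_below_step[OF _ three_sizes_sum[of 12 _ _ _ _ 1, OF optimal_in_band_12 three_sizes_0]]) simp_all
  then have "solved_below 18"
    by (rule solved_below_step[OF _ three_sizes_sum[of 15 _ _ _ _ 1, OF optimal_in_band_15 three_sizes_0]]) simp_all
  then have "solved_below 21"
    by (rule solved_below_step[OF _ three_sizes_sum[of 18 _ _ _ _ 1, OF optimal_in_band_18 three_sizes_0]]) simp_all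
  then have "solved_below 24"
    by (rule solved_below_step[OF _ three_sizes_sum[of 21 _ _ _ _ 1, OF optimal_in_band_21 three_sizes_0]]) simp_all
  then have "solved_below 27"
    by (rule solved_below_step[OF _ three_sizes_sum[of 24 _ _ _ _ 1, OF optimal_in_band_24 three_sizes_0]]) simp_all
  then have "solved_below 30"
    by (rule solved_below_step[OF _ three_sizes_sum[of 27 _ _ _ _ 1, OF optimal_in_band_27 three_sizes_0]]) simp_all
  then have "solved_below 33"
    by (rule solved_below_step[OF _ three_sizes_sum[of 6 _ _ _ _ 5, OF optimal_in_band_6 three_sizes_0]]) simp_all
  then have "solved_below 36"
    by (rule solved_below_step[OF _ three_sizes_sum[of 33 _ _ _ _ 1, OF optimal_in_band_33 three_sizes_0]]) simp_all
  then have "solved_below 39"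
    by (rule solved_below_step[OF _ three_sizes_sum[of 36 _ _ _ _ 1, OF optimal_in_band_36 three_sizes_0]]) simp_all
  then have "solved_below 42"
    by (rule solved_below_step[OF _ three_sizes_sum[of 39 _ _ _ _ 1, OF optimal_in_band_39 three_sizes_0]]) simp_all
  then have "solved_below 45"
    by (rule solved_below_step[OF _ three_sizes_sum[of 6 _ _ _ _ 7, OF optimal_in_band_6 three_sizes_0]]) simp_all
  then have "solved_below 48"
    by (rule solved_below_step[OF _ three_sizes_sum[of 45 _ _ _ _ 1, OF optimal_in_band_45 three_sizes_0]]) simp_all
  then have "solved_below 51"
    by (rule solved_below_step[OF _ three_sizes_sum[of 48 _ _ _ _ 1, OF optimal_in_band_48 three_sizes_0]]) simp_all
  then have "solved_below 54"
    by (rule solved_below_step[OF _ three_sizes_sum[of 51 _ _ _ _ 1, OF optimal_in_band_51 three_sizes_0]]) simp_all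
  then have "solved_below 57"
    by (rule solved_below_step[OF _ three_sizes_sum[of 54 _ _ _ _ 1, OF optimal_in_band_54 three_sizes_0]]) simp_all
  then have "solved_below 60"
    by (rule solved_below_step[OF _ three_sizes_sum[of 57 _ _ _ _ 1, OF optimal_in_band_57 three_sizes_0]]) simp_all
  then have "solved_below 63"
    by (rule solved_below_step[OF _ three_sizes_sum[of 12 _ _ _ _ 5, OF optimal_in_band_12 three_sizes_0]]) simp_all
  then have "solved_below 66"
    by (rule solved_below_step[OF _ three_sizes_sum[of 63 _ _ _ _ 1, OF optimal_in_band_63 three_sizes_0]]) simp_all
  then have "solved_below 69"
    by (rule solved_below_step[OF _ three_sizes_sum[of 6 _ _ _ _ 11, OF optimal_in_band_6 three_sizes_0]]) simp_all
  then have "solved_below 72"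
    by (rule solved_below_step[OF _ three_sizes_sum[of 12 _ _ _ _ 5, OF optimal_in_band_12 three_sizes_9]]) simp_all
  then have "solved_below 75"
    by (rule solved_below_step[OF _ three_sizes_sum[of 6 _ _ _ _ 11, OF optimal_in_band_6 three_sizes_6]]) simp_all
  then have "solved_below 78"
    by (rule solved_below_step[OF _ three_sizes_sum[of 15 _ _ _ _ 5, OF optimal_in_band_15 three_sizes_0]]) simp_all
  then have "solved_below 81"
    by (rule solved_below_step[OF _ three_sizes_sum[of 6 _ _ _ _ 13, OF optimal_in_band_6 three_sizes_0]]) simp_all
  then have "solved_below 84"
    by (rule solved_below_step[OF _ three_sizes_sum[of 15 _ _ _ _ 5, OF optimal_in_band_15 three_sizes_6]]) simp_all
  then have "solved_below 87"
    by (rule solved_below_step[OF _ three_sizes_sum[of 12 _ _ _ _ 7, OF optimal_in_band_12 three_sizes_0]]) simp_all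
  then have "solved_below 90"
    by (rule solved_below_step[OF _ three_sizes_sum[of 87 _ _ _ _ 1, OF optimal_in_band_87 three_sizes_0]]) simp_all
  then have "solved_below 96"
    by (rule solved_below_interval[of _ 12 _ _ 7, OF _ optimal_in_band_12]) simp_all
  then have "solved_below 99"
    by (rule solved_below_step[OF _ three_sizes_sum[of 18 _ _ _ _ 5, OF optimal_in_band_18 three_sizes_6]]) simp_all
  then have "solved_below 102"
    by (rule solved_below_step[OF _ three_sizes_sum[of 18 _ _ _ _ 5, OF optimal_in_band_18 three_sizes_9]]) simp_all
  then have "solved_below 105"
    by (rule solved_below_step[OF _ three_sizes_sum[of 6 _ _ _ _ 17, OF optimal_in_band_6 three_sizes_0]]) simp_all
  then have "solved_below 108"
    by (rule solved_below_step[OF _ three_sizes_sum[of 15 _ _ _ _ 7, OF optimal_in_band_15 three_sizes_0]]) simp_all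
  then have "solved_below 111"
    by (rule solved_below_step[OF _ three_sizes_sum[of 6 _ _ _ _ 17, OF optimal_in_band_6 three_sizes_6]]) simp_all
  then have "solved_below 117"
    by (rule solved_below_interval[of _ 15 _ _ 7, OF _ optimal_in_band_15]) simp_all
  then have "solved_below 120"
    by (rule solved_below_step[OF _ three_sizes_sum[of 15 _ _ _ _ 7, OF optimal_in_band_15 three_sizes_12]]) simp_all
  then have "solved_below 123"
    by (rule solved_below_step[OF _ three_sizes_sum[of 24 _ _ _ _ 5, OF optimal_in_band_24 three_sizes_0]]) simp_all
  then have "solved_below 126"
    by (rule solved_below_step[OF _ three_sizes_sum[of 6 _ _ _ _ 19, OF optimal_in_band_6 three_sizes_9]]) simp_all
  then have "solved_below 129"
    by (rule solved_below_step[OF _ three_sizes_sum[of 18 _ _ _ _ 7, OF optimal_in_band_18 three_sizes_0]]) simp_all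
  then have "solved_below 132"
    by (rule solved_below_step[OF _ three_sizes_sum[of 24 _ _ _ _ 5, OF optimal_in_band_24 three_sizes_9]]) simp_all
  then have "solved_below 138"
    by (rule solved_below_interval[of _ 18 _ _ 7, OF _ optimal_in_band_18]) simp_all
  then have "solved_below 150"
    by (rule solved_below_interval[of _ 12 _ _ 11, OF _ optimal_in_band_12]) simp_all
  then have "solved_below 153"
    by (rule solved_below_step[OF _ three_sizes_sum[of 6 _ _ _ _ 25, OF optimal_in_band_6 three_sizes_0]]) simp_all
  then have "solved_below 159"
    by (rule solved_below_interval[of _ 21 _ _ 7, OF _ optimal_in_band_21]) simp_all
  then have "solved_below 162"
    by (rule solved_below_step[OF _ three_sizes_sum[of 6 _ _ _ _ 25, OF optimal_in_band_6 three_sizes_9]]) simp_all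
  then have "solved_below 177"
    by (rule solved_below_interval[of _ 12 _ _ 13, OF _ optimal_in_band_12]) simp_all
  then have "solved_below 183"
    by (rule solved_below_interval[of _ 15 _ _ 11, OF _ optimal_in_band_15]) simp_all
  then have "solved_below 189"
    by (rule solved_below_interval[of _ 6 _ _ 29, OF _ optimal_in_band_6]) simp_all
  then have "solved_below 192"
    by (rule solved_below_step[OF _ three_sizes_sum[of 27 _ _ _ _ 7, OF optimal_in_band_27 three_sizes_0]]) simp_all
  then have "solved_below 201"
    by (rule solved_below_interval[of _ 6 _ _ 31, OF _ optimal_in_band_6]) simp_all
  then have "solved_below 216"
    by (rule solved_below_interval[of _ 15 _ _ 13, OF _ optimal_in_band_15]) simp_all
  then have "solved_below 231"
    by (rule solved_below_interval[of _ 12 _ _ 17, OF _ optimal_in_band_12]) simp_all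
  then have "solved_below 240"
    by (rule solved_below_interval[of _ 6 _ _ 37, OF _ optimal_in_band_6]) simp_all
  then have "solved_below 258"
    by (rule solved_below_interval[of _ 12 _ _ 19, OF _ optimal_in_band_12]) simp_all
  then have "solved_below 267"
    by (rule solved_below_interval[of _ 6 _ _ 41, OF _ optimal_in_band_6]) simp_all
  then have "solved_below 282"
    by (rule solved_below_interval[of _ 15 _ _ 17, OF _ optimal_in_band_15]) simp_all
  then have "solved_below 312"
    by (rule solved_below_interval[of _ 12 _ _ 23, OF _ optimal_in_band_12]) simp_all
  then have "solved_below 339"
    by (rule solved_below_interval[of _ 12 _ _ 25, OF _ optimal_in_band_12]) simp_all
  then have "solved_below 357"
    by (rule solved_below_interval[of _ 6 _ _ 55, OF _ optimal_in_band_6]) simp_all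
  then have "solved_below 393"
    by (rule solved_below_interval[of _ 12 _ _ 29, OF _ optimal_in_band_12]) simp_all
  then have "solved_below 420"
    by (rule solved_below_interval[of _ 12 _ _ 31, OF _ optimal_in_band_12]) simp_all
  then show ?thesis
    by (rule solved_below_interval[of _ 18 _ _ 23, OF _ optimal_in_band_18]) simp_all
qed

text \<open>From size 450 on the host of size 12 alone suffices. Consecutive numbers coprime to \<open>6\<close>
  differ by at most \<open>4\<close>, so some such \<open>q\<close> leaves \<open>p = m - 12 q\<close> between \<open>6\<close> and \<open>53\<close>, in fact at
  most \<open>51\<close> by divisibility. The host enlarged by \<open>q\<close> has all differences at least \<open>2 q - q div
  2\<close>, which is at least \<open>53\<close> once \<open>q \<ge> 35\<close> and hence exceeds the largest difference \<open>p + 1\<close> of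
  the corner boards.\<close>

lemma three_sizes_all: "3 dvd m \<Longrightarrow> 6 \<le> m \<Longrightarrow> three_sizes m (int m + 1)"
proof (induction m rule: less_induct)
  case (less m)
  show ?case
  proof (cases "m < 450")
    case True
    then show ?thesis using solved_below_450 less.prems unfolding solved_below_def by blast
  next
    case False
    define u where "u = (m - 6) div 12"
    define k where "k = u div 6"
    have k: "u = 6 * k + u mod 6" "6 \<le> k" using False by (simp_all add: k_def u_def)
    \<comment> \<open>the largest number coprime to \<open>6\<close> that is at most \<open>u\<close>\<close>
    define q where "q = (if u mod 6 = 0 then 6 * (k - 1) + 5 else if u mod 6 = 5 then u else 6 * k + 1)"
    have q: "q \<le> u" "u \<le> q + 3" "q mod 6 = 1 \<or> q mod 6 = 5"
      using k unfolding q_def by (auto split: if_splits)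
    define p where "p = m - q * 12"
    have bounds: "34 \<le> q" "q * 12 + 6 \<le> m" "m \<le> q * 12 + 53"
      using q(1,2) False unfolding u_def by auto
    then have "35 \<le> q" using q(3) by presburger
    with bounds have p: "m = q * 12 + p" "6 \<le> p" "p \<le> 53" "p < m" by (auto simp: p_def)
    have "3 dvd p" using p(1) less.prems(1) by presburger
    then have "p \<le> 51" using p(3) by presburger
    have "three_sizes p (int p + 1)" using less.IH p(2,4) \<open>3 dvd p\<close> by blast
    moreover have "int p + 1 < int q * 2 - int (q div 2)" using \<open>35 \<le> q\<close> \<open>p \<le> 51\<close> by linarith
    ultimately have "three_sizes m (max (int q * 9 + int (q div 2)) (int p + 1))"
      unfolding p(1) using q(3) by (intro three_sizes_sum[OF optimal_in_band_12]) auto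
    then show ?thesis by (rule three_sizes_trivial_band)
  qed
qed

section \<open>The maximal number of queens\<close>

lemma max_queens_eqI:
  assumes "Q \<subseteq> board n" "paired Q" "card Q = k"
    and "\<And>Q. Q \<subseteq> board n \<Longrightarrow> paired Q \<Longrightarrow> card Q \<le> k"
  shows "max_queens n = k"
  unfolding max_queens_def
proof (rule Max_eqI)
  show "finite (card ` one_attack_placements n)" using finite_one_attack_placements by simp
  show "y \<le> k" if "y \<in> card ` one_attack_placements n" for y
    using that assms(4) unfolding one_attack_placements_eq by auto
  show "k \<in> card ` one_attack_placements n" using assms(1-3) unfolding one_attack_placements_eq by blast
qed

lemma max_queens_optimal:
  assumes "optimal_in_band n l h"
  shows "max_queens n = 2 * (2 * n div 3)"
  using assms paired_card_le(2) max_queens_eqI unfolding optimal_in_band_def by metis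

text \<open>If the counting bound exceeds by one pair what a smaller board offers, and the search
  excludes the additional pair, then the smaller placement is optimal, because the number of
  queens is even.\<close>

lemma max_queens_exceptional:
  assumes "optimal_in_band m l h" "m \<le> n" "2 * n div 3 = Suc (2 * m div 3)"
    and "\<not> pairs_fit (2 * n div 3) (cells n)"
  shows "max_queens n = 2 * (2 * m div 3)"
proof -
  obtain Q where Q: "Q \<subseteq> board m" "paired Q" "card Q = 2 * (2 * m div 3)"
    using assms(1) unfolding optimal_in_band_def by blast
  have "board m \<subseteq> board n" using assms(2) by (auto simp: board_def)
  moreover have "card P \<le> 2 * (2 * m div 3)" if P: "P \<subseteq> board n" "paired P" for P
  proof -
    have "card P \<noteq> 2 * (2 * n div 3)"
      using pairs_fit_complete[OF P(2), of "cells n"] P(1) assms(4) set_cells by auto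
    then show ?thesis using paired_card_le[OF P] assms(3) by (auto elim!: evenE)
  qed
  ultimately show ?thesis using Q by (intro max_queens_eqI[of Q]) auto
qed

theorem corollary2p3:
  shows "max_queens 1 = 0 \<and> max_queens 2 = 2 \<and> max_queens 3 = 2 \<and>
         max_queens 4 = 4 \<and> max_queens 5 = 4 \<and>
         (\<forall>n::nat. n \<ge> 6 \<longrightarrow> int (max_queens n) = 2 * \<lfloor>2 * real n / 3\<rfloor>)"
proof (intro conjI allI impI)
  show "max_queens 1 = 0" using max_queens_optimal[OF optimal_in_band_1] by simp
  show "max_queens 2 = 2" using max_queens_optimal[OF optimal_in_band_2] by simp
  show "max_queens 3 = 2"
    using max_queens_exceptional[OF optimal_in_band_2, of 3] no_two_pairs_3 by simp
  show "max_queens 4 = 4" using max_queens_optimal[OF optimal_in_band_4] by simp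
  show "max_queens 5 = 4"
    using max_queens_exceptional[OF optimal_in_band_4, of 5] no_three_pairs_5 by simp
  fix n :: nat assume "n \<ge> 6"
  define m where "m = 3 * (n div 3)"
  have m: "3 dvd m" "6 \<le> m" "n = m + n mod 3" using \<open>n \<ge> 6\<close> by (auto simp: m_def)
  have "optimal_in_band (m + n mod 3) 0 (int m + 1)"
    using three_sizes_all[OF m(1,2)] unfolding three_sizes_def by simp
  then have "max_queens n = 2 * (2 * n div 3)" using max_queens_optimal m(3) by metis
  moreover have "\<lfloor>2 * real n / 3\<rfloor> = int (2 * n div 3)"
    using floor_divide_of_nat_eq[of "2 * n" 3, where ?'a = real] by simp
  ultimately show "int (max_queens n) = 2 * \<lfloor>2 * real n / 3\<rfloor>" by simp
qed

end
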